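(* Let $d\geq 3$. For most norms $\|\cdot\|$ on $\mathbb R^d$, the unit distance graph of $\|\cdot\|$ contains a copy of $K_{d,m}$ for every positive integer $m$. That is, there is a comeagre set $\mathcal A\subseteq\mathcal B_d$ such that for every $B\in\mathcal A$ and every $m\geq 1$, the unit distance graph of $\|\cdot\|_B$ contains $K_{d,m}$ as a (not necessarily induced) subgraph.
   Context: A unit ball in $\mathbb R^d$ is a set $B\subset\mathbb R^d$ that is compact, convex, symmetric about $0$, and contains a neighborhood of $0$; its norm is $\|x\|_B=\min\{r\geq0: x\in rB\}$. Every norm on $\mathbb R^d$ arises this way from its closed unit ball. $\mathcal B_d$ is the set of all unit balls in $\mathbb R^d$, with the Hausdorff distance $d_H(A,B)=\max\{\sup_{a\in A}\inf_{b\in B}\|a-b\|_2,\ \sup_{b\in B}\inf_{a\in A}\|a-b\|_2\}$. A set $\mathcal A\subseteq\mathcal B_d$ is comeagre if it is a countable intersection of sets each of which has dense interior in $\mathcal B_d$; a property holds for "most norms" if it holds for $\|\cdot\|_B$ for all $B$ in some comeagre set. The unit distance graph of a norm $\|\cdot\|$ on $\mathbb R^d$ has vertex set $\mathbb R^d$, with $x,y$ adjacent iff $\|x-y\|=1$. *)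

theory Defs
  imports "HOL-Analysis.Analysis" "Graph_Theory.Kuratowski"
begin

definition unit_balls :: "'a::euclidean_space set set" where
  "unit_balls = {B. compact B \<and> convex B \<and> (\<forall>x\<in>B. - x \<in> B) \<and> 0 \<in> interior B}"

text \<open>The least element exists whenever \<^term>\<open>B \<in> unit_balls\<close>; see \<open>ball_norm_attained\<close> below.\<close>

definition ball_norm :: "'a::euclidean_space set \<Rightarrow> 'a \<Rightarrow> real" where
  "ball_norm B x = (LEAST r. 0 \<le> r \<and> x \<in> (\<lambda>b. r *\<^sub>R b) ` B)"

text \<open>
  The case distinction only makes the function total and nonnegative, as the locale
  \<^locale>\<open>Metric_space\<close> demands; suprema and infima of sets of reals are unspecified for
  empty or unbounded sets. Unit balls are nonempty and bounded.
\<close>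

definition hausdorff_dist :: "'a::euclidean_space set \<Rightarrow> 'a set \<Rightarrow> real" where
  "hausdorff_dist A B =
     (if A \<noteq> {} \<and> B \<noteq> {} \<and> bounded A \<and> bounded B
      then max (SUP a\<in>A. INF b\<in>B. dist a b) (SUP b\<in>B. INF a\<in>A. dist a b)
      else 0)"

definition unit_ball_topology :: "'a::euclidean_space set topology" where
  "unit_ball_topology = Metric_space.mtopology unit_balls hausdorff_dist"

text \<open>
  Intersecting with \<^term>\<open>topspace X\<close> is only relevant for the empty family, whose
  intersection is the whole space.
\<close>

definition comeagre_in :: "'b topology \<Rightarrow> 'b set \<Rightarrow> bool" where
  "comeagre_in X A \<longleftrightarrow>
     (\<exists>\<U>. countable \<U> \<and>
          (\<forall>U\<in>\<U>. U \<subseteq> topspace X \<and> X closure_of (X interior_of U) = topspace X) \<and>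
          A = topspace X \<inter> \<Inter>\<U>)"

text \<open>Undirected graphs are represented as symmetric digraphs.\<close>

definition unit_distance_graph :: "('a::euclidean_space \<Rightarrow> real) \<Rightarrow> ('a, 'a \<times> 'a) pre_digraph" where
  "unit_distance_graph N = with_proj \<lparr>pverts = UNIV, parcs = {(x, y). N (x - y) = 1}\<rparr>"

definition contains_complete_bipartite :: "('a, 'b) pre_digraph \<Rightarrow> nat \<Rightarrow> nat \<Rightarrow> bool" where
  "contains_complete_bipartite G k m \<longleftrightarrow>
     (\<exists>H. subgraph H G \<and> complete_bipartite_digraph k m H)"


lemma ball_norm_attained:
  assumes "B \<in> unit_balls"
  shows "0 \<le> ball_norm B x \<and> x \<in> (\<lambda>b. ball_norm B x *\<^sub>R b) ` B"
    and "\<lbrakk>0 \<le> r; x \<in> (\<lambda>b. r *\<^sub>R b) ` B\<rbrakk> \<Longrightarrow> ball_norm B x \<le> r"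
proof -
  define S where "S = {r. 0 \<le> r \<and> x \<in> (\<lambda>b. r *\<^sub>R b) ` B}"
  have cB: "compact B" and B0: "0 \<in> interior B"
    using assms by (auto simp: unit_balls_def)
  obtain e where e: "e > 0" "cball 0 e \<subseteq> B"
    using B0 by (meson mem_interior_cball)
  have ne: "S \<noteq> {}"
  proof (cases "x = 0")
    case True
    moreover have "0 \<in> B" using B0 interior_subset by blast
    ultimately have "0 \<in> S" by (auto simp: S_def image_iff)
    then show ?thesis by blast
  next
    case False
    have "(e / norm x) *\<^sub>R x \<in> B"
      using e False by (intro subsetD[OF e(2)]) auto
    then have "norm x / e \<in> S"
      using e False by (auto simp: S_def image_iff intro!: bexI[of _ "(e / norm x) *\<^sub>R x"])
    then show ?thesis by blast
  qed
  have cl: "closed S"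
    unfolding closed_sequential_limits
  proof (intro allI impI, elim conjE)
    fix f l assume f: "\<forall>n. f n \<in> S" and l: "f \<longlonglongrightarrow> l"
    have l0: "0 \<le> l" using f l by (intro LIMSEQ_le_const[OF l]) (auto simp: S_def)
    obtain b where b: "\<And>n. b n \<in> B" "\<And>n. x = f n *\<^sub>R b n"
      using f unfolding S_def by (simp add: image_iff) metis
    obtain c g where c: "c \<in> B" and g: "strict_mono (g :: nat \<Rightarrow> nat)" "(b \<circ> g) \<longlonglongrightarrow> c"
      using cB b(1) unfolding compact_def by metis
    have "(\<lambda>n. (f \<circ> g) n *\<^sub>R (b \<circ> g) n) \<longlonglongrightarrow> l *\<^sub>R c"
      by (intro tendsto_scaleR LIMSEQ_subseq_LIMSEQ[OF l] g)
    moreover have "(\<lambda>n. (f \<circ> g) n *\<^sub>R (b \<circ> g) n) = (\<lambda>n. x)"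
      using b(2) by (auto simp: fun_eq_iff)
    ultimately have "x = l *\<^sub>R c" by (simp add: LIMSEQ_const_iff)
    then show "l \<in> S" using l0 c by (auto simp: S_def)
  qed
  have bdd: "bdd_below S" by (auto simp: S_def intro!: bdd_belowI[of _ 0])
  have mem: "Inf S \<in> S" using closed_contains_Inf[OF ne bdd cl] .
  have low: "Inf S \<le> r" if "r \<in> S" for r using cInf_lower[OF that bdd] .
  have eq: "ball_norm B x = Inf S"
    unfolding ball_norm_def
    by (rule Least_equality) (use mem low in \<open>auto simp: S_def\<close>)
  show "0 \<le> ball_norm B x \<and> x \<in> (\<lambda>b. ball_norm B x *\<^sub>R b) ` B"
    using mem unfolding eq by (simp add: S_def)
  show "\<lbrakk>0 \<le> r; x \<in> (\<lambda>b. r *\<^sub>R b) ` B\<rbrakk> \<Longrightarrow> ball_norm B x \<le> r"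
    unfolding eq by (rule low) (simp add: S_def)
qed

lemma hausdorff_dist_infdist:
  assumes "A \<noteq> {}" "B \<noteq> {}" "bounded A" "bounded B"
  shows "hausdorff_dist A B = max (SUP a\<in>A. infdist a B) (SUP b\<in>B. infdist b A)"
  using assms by (simp add: hausdorff_dist_def infdist_notempty dist_commute)

lemma bdd_above_infdist:
  assumes "B \<noteq> {}" "bounded A" "bounded B"
  shows "bdd_above ((\<lambda>a. infdist a B) ` A)"
proof -
  obtain b where b: "b \<in> B" using assms by blast
  obtain e where "\<forall>a\<in>A. dist b a \<le> e"
    using assms(2) bounded_any_center by blast
  then show ?thesis
    using b by (intro bdd_aboveI2[of _ _ e]) (metis dist_commute infdist_le order_trans)
qed

lemma infdist_le_hausdorff_dist:
  assumes "A \<noteq> {}" "B \<noteq> {}" "bounded A" "bounded B"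
  shows "a \<in> A \<Longrightarrow> infdist a B \<le> hausdorff_dist A B"
    and "b \<in> B \<Longrightarrow> infdist b A \<le> hausdorff_dist A B"
  using cSUP_upper[OF _ bdd_above_infdist[of B A], of a] cSUP_upper[OF _ bdd_above_infdist[of A B], of b] assms
  by (simp_all add: hausdorff_dist_infdist le_max_iff_disj)

lemma Metric_space_unit_balls:
  "Metric_space (unit_balls :: 'a::euclidean_space set set) hausdorff_dist"
proof
  fix A B :: "'a set"
  show "0 \<le> hausdorff_dist A B"
  proof (cases "A \<noteq> {} \<and> B \<noteq> {} \<and> bounded A \<and> bounded B")
    case True
    then obtain a where "a \<in> A" by blast
    then have "infdist a B \<le> hausdorff_dist A B"
      using True by (intro infdist_le_hausdorff_dist) auto
    then show ?thesis using infdist_nonneg order_trans by blast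
  qed (auto simp: hausdorff_dist_def)
  show "hausdorff_dist A B = hausdorff_dist B A"
    by (auto simp: hausdorff_dist_def max.commute dist_commute)
next
  have props: "A \<noteq> {}" "bounded A" "closed A" if "A \<in> unit_balls" for A :: "'a set"
    using that interior_subset by (auto simp: unit_balls_def compact_eq_bounded_closed)
  {
    fix A B :: "'a set"
    assume A: "A \<in> unit_balls" and B: "B \<in> unit_balls"
    note pA = props[OF A] and pB = props[OF B]
    show "hausdorff_dist A B = 0 \<longleftrightarrow> A = B"
    proof
      assume h: "hausdorff_dist A B = 0"
      have "a \<in> B" if "a \<in> A" for a
        using infdist_le_hausdorff_dist(1)[of A B a] that pA pB h infdist_nonneg[of a B]
        by (simp add: in_closed_iff_infdist_zero)
      moreover have "b \<in> A" if "b \<in> B" for b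
        using infdist_le_hausdorff_dist(2)[of A B b] that pA pB h infdist_nonneg[of b A]
        by (simp add: in_closed_iff_infdist_zero)
      ultimately show "A = B" by blast
    next
      assume "A = B"
      then show "hausdorff_dist A B = 0" using pA by (simp add: hausdorff_dist_infdist)
    qed
    fix C :: "'a set"
    assume C: "C \<in> unit_balls"
    note pC = props[OF C]
    have half: "infdist x Z \<le> infdist x Y + h" 
      if "Y \<noteq> {}" "\<And>y. y \<in> Y \<Longrightarrow> infdist y Z \<le> h" for x h and Y Z :: "'a set"
    proof -
      have "infdist x Z - h \<le> infdist x Y"
        unfolding infdist_notempty[OF that(1)]
        by (rule cINF_greatest[OF that(1)])
           (use that(2) infdist_triangle[of x Z] in \<open>smt (verit)\<close>)
      then show ?thesis by simp
    qed
    have 1: "infdist a C \<le> hausdorff_dist A B + hausdorff_dist B C" if "a \<in> A" for a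
      using half[of B C "hausdorff_dist B C" a] infdist_le_hausdorff_dist(1)[of A B a]
        infdist_le_hausdorff_dist(1)[of B C] that pA pB pC by force
    have 2: "infdist c A \<le> hausdorff_dist A B + hausdorff_dist B C" if "c \<in> C" for c
      using half[of B A "hausdorff_dist A B" c] infdist_le_hausdorff_dist(2)[of B C c]
        infdist_le_hausdorff_dist(2)[of A B] that pA pB pC by force
    show "hausdorff_dist A C \<le> hausdorff_dist A B + hausdorff_dist B C"
      using 1 2 pA pC by (auto simp: hausdorff_dist_infdist[of A C] intro!: cSUP_least)
  }
qed

lemma topspace_unit_ball_topology [simp]: "topspace unit_ball_topology = unit_balls"
  unfolding unit_ball_topology_def
  by (rule Metric_space.topspace_mtopology[OF Metric_space_unit_balls])

end

theory Submission
  imports Defs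
begin

text \<open>
  Let \<open>v\<close> be a point of \<open>B\<close> farthest from the origin. Near \<open>v\<close> place the points \<open>q j - p i\<close> on a
  strictly convex paraboloid that contains a sumset of two parabolas, enlarge \<open>B\<close> slightly and cut
  it by slabs whose boundary planes are almost tangent to the paraboloid at these points. The new unit
  ball is close to \<open>B\<close>, its norm is linear near each \<open>q j - p i\<close>, and the slabs can be chosen such that
  for fixed \<open>j\<close> these linear forms are independent. So the unit spheres around the \<open>d\<close> points \<open>p i\<close>
  meet transversally at every \<open>q j\<close>, and Brouwer's theorem shows that the crossings
  survive any small perturbation of the norm.
\<close>

section \<open>Norms and Hausdorff distance\<close>

lemma ball_norm_nonneg: "B \<in> unit_balls \<Longrightarrow> 0 \<le> ball_norm B x"
  using ball_norm_attained(1) by blast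

lemma unit_ball_zero: "B \<in> unit_balls \<Longrightarrow> 0 \<in> B"
  using interior_subset by (auto simp: unit_balls_def)

lemma unit_ball_shrink:
  assumes "B \<in> unit_balls" "b \<in> B" "0 \<le> t" "t \<le> 1"
  shows "t *\<^sub>R b \<in> B"
  using assms unit_ball_zero[OF assms(1)] mem_convex_alt[of B b 0 t "1 - t"]
  by (auto simp: unit_balls_def)

text \<open>The dilates \<open>r B\<close> grow with \<open>r\<close>, since \<open>B\<close> is
  convex and contains \<open>0\<close>. This replaces the least scale by a membership test. The case
  \<open>r = 0\<close> is separate because the proof divides by \<open>r\<close>.\<close>

lemma ball_norm_le_iff:
  assumes B: "B \<in> unit_balls" and r: "0 \<le> r"
  shows "ball_norm B x \<le> r \<longleftrightarrow> x \<in> (\<lambda>b. r *\<^sub>R b) ` B"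
proof
  assume le: "ball_norm B x \<le> r"
  obtain b where b: "b \<in> B" "x = ball_norm B x *\<^sub>R b"
    using ball_norm_attained(1)[OF B, of x] by blast
  show "x \<in> (\<lambda>b. r *\<^sub>R b) ` B"
  proof (cases "r = 0")
    case True
    then have "x = 0" using le b ball_norm_nonneg[OF B, of x] by simp
    then show ?thesis using True b by auto
  next
    case False
    then have "(ball_norm B x / r) *\<^sub>R b \<in> B"
      using le r b ball_norm_nonneg[OF B, of x] by (intro unit_ball_shrink[OF B]) auto
    moreover have "x = r *\<^sub>R ((ball_norm B x / r) *\<^sub>R b)" using False b(2) by simp
    ultimately show ?thesis by blast
  qed
qed (use ball_norm_attained(2)[OF B r] in blast)

lemma ball_norm_le_1_iff: "B \<in> unit_balls \<Longrightarrow> ball_norm B x \<le> 1 \<longleftrightarrow> x \<in> B"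
  using ball_norm_le_iff[of B 1 x] by auto

lemma ball_normE:
  assumes "B \<in> unit_balls"
  obtains b where "b \<in> B" "x = ball_norm B x *\<^sub>R b"
  using ball_norm_attained(1)[OF assms, of x] by blast

lemma ball_norm_zero: "B \<in> unit_balls \<Longrightarrow> ball_norm B 0 = 0"
  using ball_norm_le_iff[of B 0 0] ball_norm_nonneg[of B 0] unit_ball_zero by fastforce

lemma ball_norm_minus:
  assumes "B \<in> unit_balls"
  shows "ball_norm B (- x) = ball_norm B x"
proof -
  have "ball_norm B (- x) \<le> ball_norm B x" for x
  proof (rule ball_normE[OF assms, of x])
    fix b assume b: "b \<in> B" and x: "x = ball_norm B x *\<^sub>R b"
    have "- b \<in> B" using assms b by (auto simp: unit_balls_def)
    moreover have "- x = ball_norm B x *\<^sub>R (- b)" using x by simp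
    ultimately show ?thesis
      using ball_norm_le_iff[OF assms ball_norm_nonneg[OF assms]] by blast
  qed
  from this[of x] this[of "- x"] show ?thesis by simp
qed

text \<open>Convexity of \<open>B\<close>: the sum, divided by \<open>r + s\<close>, is the convex
  combination of \<open>b\<close> and \<open>c\<close> with weights \<open>r / (r + s)\<close> and
  \<open>s / (r + s)\<close>.\<close>

lemma ball_norm_triangle:
  assumes B: "B \<in> unit_balls"
  shows "ball_norm B (x + y) \<le> ball_norm B x + ball_norm B y"
proof -
  define r where "r = ball_norm B x"
  define s where "s = ball_norm B y"
  have rs: "0 \<le> r" "0 \<le> s" using ball_norm_nonneg[OF B] by (auto simp: r_def s_def)
  obtain b c where b: "b \<in> B" "x = r *\<^sub>R b" and c: "c \<in> B" "y = s *\<^sub>R c"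
    using ball_normE[OF B] unfolding r_def s_def by metis
  have "x + y \<in> (\<lambda>b. (r + s) *\<^sub>R b) ` B"
  proof (cases "r + s = 0")
    case True
    then have "r = 0" "s = 0" using rs by auto
    then show ?thesis using b c by auto
  next
    case False
    have "(r / (r + s)) *\<^sub>R b + (s / (r + s)) *\<^sub>R c \<in> B"
      using B b c rs False
      by (intro convexD) (auto simp: unit_balls_def add_divide_distrib[symmetric])
    moreover have "x + y = (r + s) *\<^sub>R ((r / (r + s)) *\<^sub>R b + (s / (r + s)) *\<^sub>R c)"
      using False b c by (simp add: scaleR_add_right)
    ultimately show ?thesis by blast
  qed
  then show ?thesis
    using ball_norm_le_iff[OF B, of "r + s"] rs by (simp add: r_def s_def)
qed

lemma ball_norm_le_norm:
  assumes B: "B \<in> unit_balls" and \<rho>: "\<rho> > 0" "cball 0 \<rho> \<subseteq> B"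
  shows "ball_norm B x \<le> norm x / \<rho>"
proof (cases "x = 0")
  case False
  have "(\<rho> / norm x) *\<^sub>R x \<in> B" using \<rho> False by (intro subsetD[OF \<rho>(2)]) auto
  moreover have "x = (norm x / \<rho>) *\<^sub>R ((\<rho> / norm x) *\<^sub>R x)" using \<rho> False by simp
  ultimately have "x \<in> (\<lambda>b. (norm x / \<rho>) *\<^sub>R b) ` B" by (rule image_eqI[rotated])
  then show ?thesis using ball_norm_attained(2)[OF B] \<rho> by simp
qed (use ball_norm_zero[OF B] in simp)

lemma unit_ball_cball:
  assumes "B \<in> unit_balls"
  obtains \<rho> where "\<rho> > 0" "cball 0 \<rho> \<subseteq> B"
  using assms mem_interior_cball[of 0 B] by (auto simp: unit_balls_def)

lemma continuous_on_ball_norm: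
  assumes B: "B \<in> unit_balls"
  shows "continuous_on S (ball_norm B)"
proof -
  obtain \<rho> where \<rho>: "\<rho> > 0" "cball 0 \<rho> \<subseteq> B" using unit_ball_cball[OF B] .
  have *: "ball_norm B x \<le> ball_norm B y + dist x y / \<rho>" for x y
    using ball_norm_triangle[OF B, of "x - y" y] ball_norm_le_norm[OF B \<rho>, of "x - y"]
    by (simp add: dist_norm)
  show ?thesis
    unfolding continuous_on_iff
  proof (intro ballI allI impI)
    fix x and e :: real assume "x \<in> S" "0 < e"
    then show "\<exists>d>0. \<forall>x'\<in>S. dist x' x < d \<longrightarrow> dist (ball_norm B x') (ball_norm B x) < e"
    proof (intro exI[of _ "e * \<rho>"] conjI ballI impI)
      fix y assume "dist y x < e * \<rho>"
      then have "dist y x / \<rho> < e" using \<rho> by (simp add: field_simps)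
      then show "dist (ball_norm B y) (ball_norm B x) < e"
        using *[of x y] *[of y x] by (auto simp: dist_real_def dist_commute abs_less_iff)
    qed (use \<rho> in auto)
  qed
qed

text \<open>By homogeneity, a bound on \<open>B\<close> for the norm of \<open>A\<close> extends to
  all vectors, so comparing two norms reduces to comparing two sets.\<close>

lemma ball_norm_le_scaled:
  assumes A: "A \<in> unit_balls" and B: "B \<in> unit_balls" and c: "0 \<le> c"
    and sub: "\<And>b. b \<in> B \<Longrightarrow> ball_norm A b \<le> c"
  shows "ball_norm A x \<le> c * ball_norm B x"
proof -
  obtain b where b: "b \<in> B" "x = ball_norm B x *\<^sub>R b" using ball_normE[OF B] .
  obtain a where a: "a \<in> A" "b = c *\<^sub>R a" using sub[OF b(1)] ball_norm_le_iff[OF A c] by blast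
  have "x = (c * ball_norm B x) *\<^sub>R a" using b a by (simp add: mult.commute)
  then have "x \<in> (\<lambda>a. (c * ball_norm B x) *\<^sub>R a) ` A" using a(1) by (rule image_eqI)
  then show ?thesis using ball_norm_attained(2)[OF A] c ball_norm_nonneg[OF B] by simp
qed

lemma ball_norm_scaleR:
  assumes B: "B \<in> unit_balls" and "0 \<le> c"
  shows "ball_norm B (c *\<^sub>R x) = c * ball_norm B x"
proof (cases "c = 0")
  case False
  have *: "ball_norm B (k *\<^sub>R y) \<le> k * ball_norm B y" if "k \<ge> 0" for k y
  proof -
    obtain b where b: "b \<in> B" "y = ball_norm B y *\<^sub>R b" using ball_normE[OF B] .
    have "k *\<^sub>R y = (k * ball_norm B y) *\<^sub>R b" by (subst b(2)) simp
    then have "k *\<^sub>R y \<in> (\<lambda>b. (k * ball_norm B y) *\<^sub>R b) ` B" using b(1) by (rule image_eqI)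
    then show ?thesis using ball_norm_attained(2)[OF B] that ball_norm_nonneg[OF B] by simp
  qed
  have "c * ball_norm B x \<le> ball_norm B (c *\<^sub>R x)"
    using *[of "1 / c" "c *\<^sub>R x"] False assms(2) by (simp add: field_simps)
  then show ?thesis using *[OF assms(2), of x] by simp
qed (use ball_norm_zero[OF B] in simp)

lemma unit_ball_props:
  assumes "B \<in> unit_balls"
  shows "B \<noteq> {}" "bounded B" "closed B" "convex B" "compact B"
  using assms interior_subset by (auto simp: unit_balls_def compact_eq_bounded_closed)

section \<open>Comparison of the norms of Hausdorff-close unit balls\<close>

text \<open>A point of \<open>B\<close> differs from its nearest point of \<open>A\<close> by at
  most the Hausdorff distance, and the ball of radius \<rho> inside \<open>A\<close> converts this
  Euclidean error into the norm of \<open>A\<close>.\<close>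

lemma ball_norm_le_hausdorff:
  assumes A: "A \<in> unit_balls" and B: "B \<in> unit_balls" and \<rho>: "\<rho> > 0" "cball 0 \<rho> \<subseteq> A"
  shows "ball_norm A x \<le> (1 + hausdorff_dist A B / \<rho>) * ball_norm B x"
proof (rule ball_norm_le_scaled[OF A B])
  note pA = unit_ball_props[OF A] and pB = unit_ball_props[OF B]
  show "0 \<le> 1 + hausdorff_dist A B / \<rho>"
    using \<rho> Metric_space.nonneg[OF Metric_space_unit_balls, of A B] by simp
  fix b assume b: "b \<in> B"
  obtain a where a: "a \<in> A" "infdist b A = dist b a"
    using infdist_attains_inf[OF pA(3,1)] .
  have "dist b a \<le> hausdorff_dist A B"
    using infdist_le_hausdorff_dist(2)[of A B b] pA pB b a by simp
  moreover have "ball_norm A (b - a) \<le> dist b a / \<rho>"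
    using ball_norm_le_norm[OF A \<rho>, of "b - a"] by (simp add: dist_norm)
  ultimately have "ball_norm A (b - a) \<le> hausdorff_dist A B / \<rho>"
    using \<rho> by (smt (verit) divide_right_mono)
  moreover have "ball_norm A a \<le> 1" using ball_norm_le_1_iff[OF A] a by blast
  ultimately show "ball_norm A b \<le> 1 + hausdorff_dist A B / \<rho>"
    using ball_norm_triangle[OF A, of "b - a" a] by simp
qed

text \<open>Exchanging \<open>A\<close> and \<open>B\<close> in
  \<open>ball_norm_le_hausdorff\<close> would bring in an inner radius of \<open>B\<close>.
  Separating hyperplanes give \<open>k A \<subseteq> B\<close> using the inner radius of
  \<open>A\<close> alone, which makes the estimate uniform in \<open>B\<close>.\<close>

lemma ball_norm_ge_hausdorff:
  assumes A: "A \<in> unit_balls" and B: "B \<in> unit_balls" and \<rho>: "\<rho> > 0" "cball 0 \<rho> \<subseteq> A"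
    and small: "hausdorff_dist A B < \<rho>"
  shows "(1 - hausdorff_dist A B / \<rho>) * ball_norm B x \<le> ball_norm A x"
proof -
  note pA = unit_ball_props[OF A] and pB = unit_ball_props[OF B]
  define k where "k = 1 - hausdorff_dist A B / \<rho>"
  have h0: "0 \<le> hausdorff_dist A B"
    using Metric_space.nonneg[OF Metric_space_unit_balls, of A B] .
  have k: "0 < k" using small \<rho> by (simp add: k_def)
  have kA: "k *\<^sub>R a \<in> B" if a: "a \<in> A" for a
  proof (rule ccontr)
    assume "k *\<^sub>R a \<notin> B"
    then obtain n \<beta> where n: "n \<bullet> (k *\<^sub>R a) < \<beta>" "\<And>b. b \<in> B \<Longrightarrow> \<beta> < n \<bullet> b"
      using separating_hyperplane_closed_point[OF pB(4,3)] by blast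
    obtain a0 where a0: "a0 \<in> A" "\<And>a'. a' \<in> A \<Longrightarrow> n \<bullet> a0 \<le> n \<bullet> a'"
      using continuous_attains_inf[OF pA(5,1), of "\<lambda>x. n \<bullet> x"] continuous_on_inner[of A "\<lambda>_. n" "\<lambda>x. x"]
      by auto
    obtain b where b: "b \<in> B" "infdist a0 B = dist a0 b"
      using infdist_attains_inf[OF pB(3,1)] .
    have "dist a0 b \<le> hausdorff_dist A B"
      using infdist_le_hausdorff_dist(1)[of A B a0] pA pB b a0 by simp
    moreover have "n \<bullet> (b - a0) \<le> norm n * dist a0 b"
      using Cauchy_Schwarz_ineq2[of n "b - a0"] by (simp add: dist_norm norm_minus_commute)
    ultimately have "n \<bullet> (b - a0) \<le> norm n * hausdorff_dist A B"
      by (meson mult_left_mono norm_ge_zero order_trans)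
    then have 1: "\<beta> < n \<bullet> a0 + norm n * hausdorff_dist A B"
      using n(2)[OF b(1)] by (simp add: inner_diff_right)
    \<comment> \<open>The minimum of the functional over \<open>A\<close> is at most its minimum
      over the ball of radius \<rho>, attained opposite to \<open>n\<close>.\<close>
    have "n \<bullet> a0 \<le> - (norm n * \<rho>)"
    proof (cases "n = 0")
      case False
      have "- (\<rho> / norm n) *\<^sub>R n \<in> A" using \<rho> False by (intro subsetD[OF \<rho>(2)]) auto
      then have "n \<bullet> a0 \<le> n \<bullet> (- (\<rho> / norm n) *\<^sub>R n)" by (rule a0(2))
      also have "\<dots> = - (norm n * \<rho>)"
        using False by (simp add: dot_square_norm power2_eq_square)
      finally show ?thesis .
    qed simp
    \<comment> \<open>Since \<open>1 - k\<close> is \<open>hausdorff_dist A B / \<rho>\<close>,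
      shrinking \<open>a0\<close> by \<open>k\<close> raises its value by at least the error term in
      fact \<open>1\<close>; this puts \<open>k a\<close> on the side of \<open>B\<close>.\<close>
    then have "(1 - k) * (n \<bullet> a0) \<le> - (norm n * hausdorff_dist A B)"
      using \<rho> h0 mult_left_mono[of "n \<bullet> a0" "- (norm n * \<rho>)" "hausdorff_dist A B / \<rho>"]
      by (simp add: k_def field_simps)
    moreover have "k * (n \<bullet> a0) \<le> k * (n \<bullet> a)" using a0(2)[OF a] k by simp
    ultimately have "\<beta> < n \<bullet> (k *\<^sub>R a)" using 1 by (simp add: algebra_simps)
    then show False using n(1) by simp
  qed
  have "ball_norm B x \<le> (1 / k) * ball_norm A x"
  proof (rule ball_norm_le_scaled[OF B A])
    fix a assume "a \<in> A"
    then have "ball_norm B (k *\<^sub>R a) \<le> 1" using kA ball_norm_le_1_iff[OF B] by blast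
    then show "ball_norm B a \<le> 1 / k" using k ball_norm_scaleR[OF B, of k a] by (simp add: field_simps)
  qed (use k in simp)
  then show ?thesis using k by (simp add: k_def[symmetric] field_simps)
qed

lemma ball_norm_uniformly_close:
  fixes A :: "'a::euclidean_space set"
  assumes A: "A \<in> unit_balls" and S: "bounded S" and \<epsilon>: "\<epsilon> > 0"
  obtains \<delta> where "\<delta> > 0"
    "\<And>B x. B \<in> unit_balls \<Longrightarrow> hausdorff_dist A B < \<delta> \<Longrightarrow> x \<in> S \<Longrightarrow> \<bar>ball_norm B x - ball_norm A x\<bar> \<le> \<epsilon>"
proof -
  obtain \<rho> where \<rho>: "\<rho> > 0" "cball 0 \<rho> \<subseteq> A" using unit_ball_cball[OF A] .
  obtain M where M: "M > 0" "\<And>x. x \<in> S \<Longrightarrow> norm x \<le> M" using S bounded_pos by metis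
  define K where "K = M / \<rho>"
  have K: "K > 0" "\<And>x. x \<in> S \<Longrightarrow> ball_norm A x \<le> K"
    using M \<rho> order_trans[OF ball_norm_le_norm[OF A \<rho>] divide_right_mono[of _ M \<rho>]]
    unfolding K_def by auto
  \<comment> \<open>The entry \<open>1 / 2\<close> yields \<open>ball_norm B x \<le> 2 * K\<close>;
    the other entry then makes the relative error \<open>l\<close> times \<open>2 * K\<close> at
    most \<epsilon>.\<close>
  define \<delta> where "\<delta> = \<rho> * min (1 / 2) (\<epsilon> / (2 * K))"
  show thesis
  proof (rule that[of \<delta>])
    show "\<delta> > 0" using \<rho> \<epsilon> K by (simp add: \<delta>_def)
    fix B x assume B: "B \<in> unit_balls" and h: "hausdorff_dist A B < \<delta>" and x: "x \<in> S"
    define l where "l = hausdorff_dist A B / \<rho>"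
    have l0: "0 \<le> l"
      using Metric_space.nonneg[OF Metric_space_unit_balls, of A B] \<rho> by (simp add: l_def)
    have "l < min (1 / 2) (\<epsilon> / (2 * K))"
      using h \<rho> unfolding l_def \<delta>_def by (subst pos_divide_less_eq) (auto simp: mult.commute)
    then have l: "l < 1 / 2" "l < \<epsilon> / (2 * K)" by auto
    then have "hausdorff_dist A B < \<rho>" using \<rho> by (simp add: l_def field_simps)
    then have 1: "(1 - l) * ball_norm B x \<le> ball_norm A x"
      using ball_norm_ge_hausdorff[OF A B \<rho>] by (simp add: l_def)
    have 2: "ball_norm A x \<le> (1 + l) * ball_norm B x"
      using ball_norm_le_hausdorff[OF A B \<rho>] by (simp add: l_def)
    have "1 / 2 * ball_norm B x \<le> (1 - l) * ball_norm B x"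
      using l ball_norm_nonneg[OF B] by (intro mult_right_mono) auto
    then have 3: "ball_norm B x \<le> 2 * K" using 1 K(2)[OF x] by simp
    have "l * ball_norm B x \<le> l * (2 * K)" using 3 l0 by (rule mult_left_mono)
    also have "\<dots> \<le> \<epsilon>" using l K(1) by (simp add: field_simps)
    finally show "\<bar>ball_norm B x - ball_norm A x\<bar> \<le> \<epsilon>" using 1 2 by (simp add: algebra_simps abs_le_iff)
  qed
qed

text \<open>\<open>B\<close> lies between the dilates of \<open>A\<close> by
  \<open>1 - \<tau>\<close> and \<open>1 + \<tau>\<close>, so a radial move of length at most
  \<open>\<tau> * R\<close> leads from either set into the other.\<close>

lemma hausdorff_dist_scaled_le:
  fixes A :: "'a::euclidean_space set"
  assumes A: "A \<in> unit_balls" and B: "B \<in> unit_balls" and R: "A \<subseteq> cball 0 R" and \<tau>: "0 \<le> \<tau>"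
    and inner: "\<And>a. a \<in> A \<Longrightarrow> (1 - \<tau>) *\<^sub>R a \<in> B"
    and outer: "\<And>b. b \<in> B \<Longrightarrow> ball_norm A b \<le> 1 + \<tau>"
  shows "hausdorff_dist A B \<le> \<tau> * R"
proof -
  note pA = unit_ball_props[OF A] and pB = unit_ball_props[OF B]
  have 1: "infdist a B \<le> \<tau> * R" if a: "a \<in> A" for a
  proof -
    have "infdist a B \<le> dist a ((1 - \<tau>) *\<^sub>R a)" by (rule infdist_le[OF inner[OF a]])
    also have "\<dots> = \<tau> * norm a" using \<tau> by (simp add: dist_norm algebra_simps)
    also have "\<dots> \<le> \<tau> * R" using R a \<tau> by (intro mult_left_mono) auto
    finally show ?thesis .
  qed
  have 2: "infdist b A \<le> \<tau> * R" if b: "b \<in> B" for b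
  proof -
    have "0 \<le> 1 + \<tau>" using \<tau> by simp
    from ball_norm_le_iff[OF A this] outer[OF b]
    obtain a where a: "a \<in> A" "b = (1 + \<tau>) *\<^sub>R a" by blast
    have "infdist b A \<le> dist b a" by (rule infdist_le[OF a(1)])
    also have "\<dots> = \<tau> * norm a" using \<tau> a by (simp add: dist_norm algebra_simps)
    also have "\<dots> \<le> \<tau> * R" using R a \<tau> by (intro mult_left_mono) auto
    finally show ?thesis .
  qed
  show ?thesis
    using 1 2 pA pB by (auto simp: hausdorff_dist_infdist intro!: cSUP_least)
qed


section \<open>Stability of transversal intersections of unit spheres\<close>

text \<open>
  If near \<open>q\<close> the functions \<open>x \<mapsto> \<parallel>x - p i\<parallel> - 1\<close> are affine with independent gradients, then for
  nearby norms the simplified Newton map \<open>x \<mapsto> x - L\<^sup>-\<^sup>1 (F x)\<close> still sends a ball around \<open>q\<close> to itself.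
\<close>

lemma stable_intersection:
  fixes B E :: "'a::euclidean_space set" and n p :: "'a \<Rightarrow> 'a"
  assumes B: "B \<in> unit_balls" and E: "independent E" and r: "r > 0"
    and inj: "\<And>x. (\<And>i. i \<in> E \<Longrightarrow> n i \<bullet> x = 0) \<Longrightarrow> x = 0"
    and affine: "\<And>i x. i \<in> E \<Longrightarrow> dist q x \<le> r \<Longrightarrow> ball_norm B (x - p i) = 1 + n i \<bullet> (x - q)"
  obtains \<delta> where "\<delta> > 0"
    "\<And>C. C \<in> unit_balls \<Longrightarrow> hausdorff_dist B C < \<delta> \<Longrightarrow>
      \<exists>x\<in>cball q r. \<forall>i\<in>E. ball_norm C (x - p i) = 1"
proof -
  have fE: "finite E" using E independent_imp_finite by blast
  have coeff: "u i = 0" if "(\<Sum>i\<in>E. u i *\<^sub>R i) = 0" "i \<in> E" for u :: "'a \<Rightarrow> real" and i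
    using E that fE unfolding independent_explicit by blast
  \<comment> \<open>Coefficients along the independent set \<open>E\<close> serve as coordinates:
    the equations indexed by \<open>E\<close> become one map from the space to itself, so a linear
    inverse and Brouwer's theorem apply.\<close>
  define L where "L x = (\<Sum>i\<in>E. (n i \<bullet> x) *\<^sub>R i)" for x
  have linL: "linear L"
    unfolding L_def
    by (rule linearI) (simp_all add: inner_add_right scaleR_add_left sum.distrib scaleR_sum_right)
  have "L x = 0 \<Longrightarrow> x = 0" for x
    unfolding L_def by (rule inj) (rule coeff)
  then have injL: "inj L" using linear_injective_0[OF linL] by blast
  obtain M where M: "linear M" "M \<circ> L = id" using linear_injective_left_inverse[OF linL injL] by blast
  have left_inv: "M (L x) = x" for x using M(2) by (metis comp_apply id_apply)
  have M0: "y = 0" if "M y = 0" for y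
  proof -
    obtain x where "y = L x" using linear_injective_imp_surjective[OF linL injL] by auto
    then show ?thesis using that left_inv linL by (metis linear_0)
  qed
  obtain K where K: "K > 0" "\<And>y. norm (M y) \<le> norm y * K"
    using bounded_linear.pos_bounded[OF linear_conv_bounded_linear[THEN iffD1, OF M(1)]] by blast
  \<comment> \<open>The sum bounds combinations of \<open>E\<close> by their largest coefficient;
    the added 1 keeps \<open>Z\<close> positive when \<open>E\<close> is empty.\<close>
  define Z where "Z = (\<Sum>i\<in>E. norm i) + 1"
  have Z: "Z > 0" by (auto simp: Z_def intro!: add_nonneg_pos sum_nonneg)
  define S where "S = (\<Union>i\<in>E. (\<lambda>x. x - p i) ` cball q r)"
  have "bounded S" unfolding S_def
    by (intro bounded_UN fE ballI compact_imp_bounded compact_continuous_image compact_cball continuous_intros)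
  moreover have "r / (K * Z) > 0" using r K Z by simp
  ultimately obtain \<delta> where \<delta>: "\<delta> > 0"
    "\<And>C x. C \<in> unit_balls \<Longrightarrow> hausdorff_dist B C < \<delta> \<Longrightarrow> x \<in> S \<Longrightarrow> \<bar>ball_norm C x - ball_norm B x\<bar> \<le> r / (K * Z)"
    using ball_norm_uniformly_close[OF B, of S "r / (K * Z)"] by blast
  show thesis
  proof (rule that[OF \<delta>(1)])
    fix C assume C: "C \<in> unit_balls" and h: "hausdorff_dist B C < \<delta>"
    define F where "F x = (\<Sum>i\<in>E. (ball_norm C (x - p i) - 1) *\<^sub>R i)" for x
    have contF: "continuous_on (cball q r) F"
      unfolding F_def
      by (intro continuous_intros continuous_on_compose2[OF continuous_on_ball_norm[OF C, of UNIV]]) auto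
    have "continuous_on (cball q r) (\<lambda>x. M (F x))"
      using continuous_on_compose2[OF linear_continuous_on[OF linear_conv_bounded_linear[THEN iffD1, OF M(1)]] contF]
      by blast
    then have "continuous_on (cball q r) (\<lambda>x. x - M (F x))" by (intro continuous_intros)
    \<comment> \<open>Relative to \<open>q\<close>, the image of \<open>x\<close> is
      \<open>M (L (x - q) - F x)\<close>: only the deviation of \<open>F\<close> from its affine
      model counts, and this has norm at most \<open>r / K\<close>.\<close>
    moreover have "(\<lambda>x. x - M (F x)) \<in> cball q r \<rightarrow> cball q r"
    proof
      fix x assume x: "x \<in> cball q r"
      have "L (x - q) - F x = (\<Sum>i\<in>E. (ball_norm B (x - p i) - ball_norm C (x - p i)) *\<^sub>R i)"
        using x affine unfolding L_def F_def sum_subtractf[symmetric] scaleR_diff_left[symmetric]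
        by (intro sum.cong) auto
      also have "norm \<dots> \<le> (\<Sum>i\<in>E. r / (K * Z) * norm i)"
      proof (rule sum_norm_le)
        fix i assume "i \<in> E"
        then have "x - p i \<in> S" using x unfolding S_def by blast
        then show "norm ((ball_norm B (x - p i) - ball_norm C (x - p i)) *\<^sub>R i) \<le> r / (K * Z) * norm i"
          using mult_right_mono[OF \<delta>(2)[OF C h, of "x - p i"] norm_ge_zero[of i]]
          by (simp add: abs_minus_commute)
      qed
      also have "\<dots> \<le> r / (K * Z) * Z"
        unfolding sum_distrib_left[symmetric] using r K Z by (intro mult_left_mono) (auto simp: Z_def)
      also have "\<dots> = r / K" using Z by simp
      finally have "norm (L (x - q) - F x) * K \<le> r" using K(1) by (simp add: field_simps)
      then have "norm (M (L (x - q) - F x)) \<le> r" using K(2) order_trans by blast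
      moreover have "M (L (x - q) - F x) = x - M (F x) - q"
        using linear_diff[OF M(1)] left_inv by simp
      ultimately show "x - M (F x) \<in> cball q r" by (simp add: dist_norm norm_minus_commute)
    qed
    ultimately obtain x where x: "x \<in> cball q r" "x - M (F x) = x"
      using brouwer_ball[OF r] by blast
    then have "F x = 0" using M0 by simp
    then have "\<forall>i\<in>E. ball_norm C (x - p i) - 1 = 0"
      unfolding F_def using coeff[of "\<lambda>i. ball_norm C (x - p i) - 1"] by blast
    then show "\<exists>x\<in>cball q r. \<forall>i\<in>E. ball_norm C (x - p i) = 1" using x(1) by auto
  qed
qed

section \<open>From common unit-distance points to complete bipartite subgraphs\<close>

lemma contains_complete_bipartite_unit_distance:
  assumes C: "C \<in> unit_balls" and U: "finite U" and V: "finite V"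
    and unit: "\<And>x y. x \<in> U \<Longrightarrow> y \<in> V \<Longrightarrow> ball_norm C (y - x) = 1"
  shows "contains_complete_bipartite (unit_distance_graph (ball_norm C)) (card U) (card V)"
proof -
  let ?H = "with_proj \<lparr>pverts = U \<union> V, parcs = U \<times> V \<union> V \<times> U\<rparr>"
  \<comment> \<open>A common point would force the zero vector to have norm 1.\<close>
  have "U \<inter> V = {}" using unit ball_norm_zero[OF C] by fastforce
  then have K: "complete_bipartite_digraph (card U) (card V) ?H"
    unfolding complete_bipartite_digraph_pair_def using U V by auto
  then interpret H: graph ?H by (simp add: complete_bipartite_digraph_def)
  have "ball_norm C (x - y) = 1" if "x \<in> U" "y \<in> V" for x y
    using unit[OF that] ball_norm_minus[OF C, of "y - x"] by simp
  then have "subgraph ?H (unit_distance_graph (ball_norm C))"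
    unfolding subgraph_def unit_distance_graph_def
    using unit H.wf_digraph_axioms by (auto intro!: wf_digraph.intro)
  then show ?thesis unfolding contains_complete_bipartite_def using K by blast
qed

text \<open>Apply \<open>stable_intersection\<close> at each \<open>q j\<close>. The perturbed
  crossings must remain distinct: each is kept strictly closer to its own \<open>q j\<close> than to
  every other centre.\<close>

lemma stable_complete_bipartite:
  fixes B E :: "'a::euclidean_space set" and p :: "'a \<Rightarrow> 'a" and q :: "'j \<Rightarrow> 'a" and n :: "'a \<Rightarrow> 'j \<Rightarrow> 'a"
  assumes B: "B \<in> unit_balls" and E: "independent E" and J: "finite J"
    and p: "inj_on p E" and q: "inj_on q J"
    and inj: "\<And>j x. j \<in> J \<Longrightarrow> (\<And>i. i \<in> E \<Longrightarrow> n i j \<bullet> x = 0) \<Longrightarrow> x = 0"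
    and affine: "\<And>i j. i \<in> E \<Longrightarrow> j \<in> J \<Longrightarrow>
      eventually (\<lambda>x. ball_norm B (x - p i) = 1 + n i j \<bullet> (x - q j)) (nhds (q j))"
  obtains \<delta> where "\<delta> > 0"
    "\<And>C. C \<in> unit_balls \<Longrightarrow> hausdorff_dist B C < \<delta> \<Longrightarrow>
      contains_complete_bipartite (unit_distance_graph (ball_norm C)) (card E) (card J)"
proof -
  have fE: "finite E" using E independent_imp_finite by blast
  have "\<exists>\<delta>>0. \<forall>C\<in>unit_balls. hausdorff_dist B C < \<delta> \<longrightarrow>
      (\<exists>x. (\<forall>k\<in>J. k \<noteq> j \<longrightarrow> dist (q j) x < dist (q k) x) \<and> (\<forall>i\<in>E. ball_norm C (x - p i) = 1))" if j: "j \<in> J" for j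
  proof -
    have "eventually (\<lambda>x. dist (q j) x < dist (q k) x) (nhds (q j))" if k: "k \<in> J" "k \<noteq> j" for k
    proof -
      have "((\<lambda>x. dist (q k) x - dist (q j) x) \<longlongrightarrow> dist (q k) (q j) - dist (q j) (q j)) (nhds (q j))"
        by (intro tendsto_intros filterlim_ident)
      moreover have "dist (q k) (q j) - dist (q j) (q j) > 0" using q j k by (auto simp: inj_on_def)
      ultimately have "eventually (\<lambda>x. 0 < dist (q k) x - dist (q j) x) (nhds (q j))"
        by (rule order_tendstoD(1))
      then show ?thesis by simp
    qed
    then have "\<forall>\<^sub>F x in nhds (q j). \<forall>k\<in>J. k \<noteq> j \<longrightarrow> dist (q j) x < dist (q k) x"
      using J by (intro eventually_ball_finite) auto
    moreover have "\<forall>\<^sub>F x in nhds (q j). \<forall>i\<in>E. ball_norm B (x - p i) = 1 + n i j \<bullet> (x - q j)"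
      using affine j fE by (intro eventually_ball_finite) auto
    ultimately have "\<forall>\<^sub>F x in nhds (q j). (\<forall>k\<in>J. k \<noteq> j \<longrightarrow> dist (q j) x < dist (q k) x) \<and>
        (\<forall>i\<in>E. ball_norm B (x - p i) = 1 + n i j \<bullet> (x - q j))"
      by (rule eventually_conj)
    then obtain r' where r': "r' > 0" "\<And>x. dist x (q j) < r' \<Longrightarrow> (\<forall>k\<in>J. k \<noteq> j \<longrightarrow> dist (q j) x < dist (q k) x) \<and>
        (\<forall>i\<in>E. ball_norm B (x - p i) = 1 + n i j \<bullet> (x - q j))"
      unfolding eventually_nhds_metric by blast
    \<comment> \<open>\<open>stable_intersection\<close> works on a closed ball; halving the radius
      places it inside the open one.\<close>
    have r: "r' / 2 > 0" using r' by simp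
    have near: "(\<forall>k\<in>J. k \<noteq> j \<longrightarrow> dist (q j) x < dist (q k) x) \<and>
        (\<forall>i\<in>E. ball_norm B (x - p i) = 1 + n i j \<bullet> (x - q j))" if "dist (q j) x \<le> r' / 2" for x
      using r' that by (intro r'(2)) (simp add: dist_commute)
    obtain \<delta> where "\<delta> > 0"
    "\<And>C. C \<in> unit_balls \<Longrightarrow> hausdorff_dist B C < \<delta> \<Longrightarrow>
      \<exists>x\<in>cball (q j) (r' / 2). \<forall>i\<in>E. ball_norm C (x - p i) = 1"
      using stable_intersection[OF B E r, of "\<lambda>i. n i j" "q j" p] inj[OF j] near by metis
    then show ?thesis using near by (metis mem_cball)
  qed
  then obtain d where d: "\<And>j. j \<in> J \<Longrightarrow> d j > 0" "\<And>j C. j \<in> J \<Longrightarrow> C \<in> unit_balls \<Longrightarrow> hausdorff_dist B C < d j \<Longrightarrow>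
      \<exists>x. (\<forall>k\<in>J. k \<noteq> j \<longrightarrow> dist (q j) x < dist (q k) x) \<and> (\<forall>i\<in>E. ball_norm C (x - p i) = 1)"
    by metis
  \<comment> \<open>The extra 1 gives the minimum a meaning when \<open>J\<close> is empty.\<close>
  define \<delta> where "\<delta> = Min (insert 1 (d ` J))"
  show thesis
  proof (rule that[of \<delta>])
    show "\<delta> > 0" using J d(1) by (simp add: \<delta>_def)
    fix C assume C: "C \<in> unit_balls" and h: "hausdorff_dist B C < \<delta>"
    have "hausdorff_dist B C < d j" if "j \<in> J" for j
      using h J that by (simp add: \<delta>_def)
    then obtain x where x: "\<And>j k. j \<in> J \<Longrightarrow> k \<in> J \<Longrightarrow> k \<noteq> j \<Longrightarrow> dist (q j) (x j) < dist (q k) (x j)"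
      "\<And>j i. j \<in> J \<Longrightarrow> i \<in> E \<Longrightarrow> ball_norm C (x j - p i) = 1"
      using d(2)[OF _ C] by metis
    have "inj_on x J"
      using x(1) by (intro inj_onI) (metis less_asym)
    then have "card (x ` J) = card J" "card (p ` E) = card E" using p by (auto simp: card_image)
    then show "contains_complete_bipartite (unit_distance_graph (ball_norm C)) (card E) (card J)"
      using contains_complete_bipartite_unit_distance[OF C, of "p ` E" "x ` J"] fE J x(2) by auto
  qed
qed


section \<open>Unit balls with prescribed flat pieces\<close>

text \<open>Intersect the dilate of \<open>B\<close> by \<open>1 + \<tau>\<close> with the slabs
  \<open>\<bar>n k \<bullet> x\<bar> \<le> 1\<close>. The bound on \<open>norm (n k)\<close> keeps
  the dilate by \<open>1 - \<tau>\<close> inside every slab, so the Hausdorff distance is small. At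
  \<open>u k\<close> only the constraint from slab \<open>k\<close> is tight, hence the boundary is
  flat there.\<close>

lemma slab_truncation:
  fixes B :: "'a::euclidean_space set" and n u :: "'k \<Rightarrow> 'a"
  assumes B: "B \<in> unit_balls" and R: "B \<subseteq> cball 0 R" and \<tau>: "0 < \<tau>" "\<tau> < 1" and K: "finite K"
    and n: "\<And>k. k \<in> K \<Longrightarrow> norm (n k) * ((1 - \<tau>) * R) \<le> 1"
    and u: "\<And>k. k \<in> K \<Longrightarrow> ball_norm B (u k) < 1 + \<tau>" "\<And>k. k \<in> K \<Longrightarrow> n k \<bullet> u k = 1"
      "\<And>k l. k \<in> K \<Longrightarrow> l \<in> K \<Longrightarrow> l \<noteq> k \<Longrightarrow> \<bar>n l \<bullet> u k\<bar> < 1"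
  obtains B' where "B' \<in> unit_balls" "hausdorff_dist B B' \<le> \<tau> * R"
    "\<And>k. k \<in> K \<Longrightarrow> eventually (\<lambda>x. ball_norm B' x = n k \<bullet> x) (nhds (u k))"
proof -
  note pB = unit_ball_props[OF B]
  define B' where "B' = (\<lambda>b. (1 + \<tau>) *\<^sub>R b) ` B \<inter> (\<Inter>k\<in>K. {x. n k \<bullet> x \<le> 1} \<inter> {x. n k \<bullet> x \<ge> -1})"
  have B'_iff: "x \<in> B' \<longleftrightarrow> ball_norm B x \<le> 1 + \<tau> \<and> (\<forall>k\<in>K. \<bar>n k \<bullet> x\<bar> \<le> 1)" for x
    using ball_norm_le_iff[OF B, of "1 + \<tau>" x] \<tau> by (auto simp: B'_def abs_le_iff)
  have inner: "(1 - \<tau>) *\<^sub>R b \<in> B'" if b: "b \<in> B" for b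
    unfolding B'_iff
  proof (intro conjI ballI)
    have "ball_norm B b \<le> 1" using ball_norm_le_1_iff[OF B] b by simp
    then have "(1 - \<tau>) * ball_norm B b \<le> 1 * 1"
      using \<tau> ball_norm_nonneg[OF B, of b] by (intro mult_mono) auto
    then show "ball_norm B ((1 - \<tau>) *\<^sub>R b) \<le> 1 + \<tau>" using ball_norm_scaleR[OF B, of "1 - \<tau>" b] \<tau> by simp
    fix k assume k: "k \<in> K"
    have "\<bar>n k \<bullet> ((1 - \<tau>) *\<^sub>R b)\<bar> \<le> norm (n k) * norm ((1 - \<tau>) *\<^sub>R b)" by (rule Cauchy_Schwarz_ineq2)
    also have "\<dots> \<le> norm (n k) * ((1 - \<tau>) * R)"
      using b R \<tau> by (intro mult_left_mono) auto
    also have "\<dots> \<le> 1" using n k by simp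
    finally show "\<bar>n k \<bullet> ((1 - \<tau>) *\<^sub>R b)\<bar> \<le> 1" .
  qed
  have "compact B'" unfolding B'_def
    using K pB by (intro compact_Int_closed compact_scaling closed_INT closed_Int ballI closed_halfspace_le closed_halfspace_ge) auto
  moreover have "convex B'" unfolding B'_def
    using pB by (intro convex_Int convex_INT convex_scaling convex_halfspace_le convex_halfspace_ge) auto
  moreover have "\<forall>x\<in>B'. - x \<in> B'" by (simp add: B'_iff ball_norm_minus[OF B])
  moreover have "0 \<in> interior B'"
  proof -
    obtain \<rho> where \<rho>: "\<rho> > 0" "cball 0 \<rho> \<subseteq> B" using unit_ball_cball[OF B] .
    have "x \<in> B'" if "norm x \<le> (1 - \<tau>) * \<rho>" for x
    proof -
      have "(1 / (1 - \<tau>)) *\<^sub>R x \<in> B"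
        using that \<tau> by (intro subsetD[OF \<rho>(2)]) (simp add: field_simps)
      from inner[OF this] show ?thesis using \<tau> by simp
    qed
    then have "cball 0 ((1 - \<tau>) * \<rho>) \<subseteq> B'" by auto
    then show ?thesis unfolding mem_interior_cball using \<rho> \<tau> by (metis diff_gt_0_iff_gt mult_pos_pos)
  qed
  ultimately have B': "B' \<in> unit_balls" by (simp add: unit_balls_def)
  show thesis
  proof (rule that[OF B'])
    show "hausdorff_dist B B' \<le> \<tau> * R"
      using hausdorff_dist_scaled_le[OF B B' R, of \<tau>] inner B'_iff \<tau> by auto
    fix k assume k: "k \<in> K"
    have tn: "((\<lambda>x. n l \<bullet> x) \<longlongrightarrow> n l \<bullet> u k) (nhds (u k))" for l
      by (intro tendsto_intros filterlim_ident)
    have tN: "(ball_norm B \<longlongrightarrow> ball_norm B (u k)) (nhds (u k))"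
      using continuous_on_ball_norm[OF B, of UNIV]
      by (metis UNIV_I continuous_on_def filterlim_def tendsto_at_iff_tendsto_nhds)
    have "eventually (\<lambda>x. 0 < n k \<bullet> x) (nhds (u k))"
      using order_tendstoD(1)[OF tn] u(2)[OF k] by simp
    moreover have "eventually (\<lambda>x. 0 < (1 + \<tau>) * (n k \<bullet> x) - ball_norm B x) (nhds (u k))"
      by (rule order_tendstoD(1)[OF tendsto_diff[OF tendsto_mult_left[OF tn] tN]])
        (use u(1,2)[OF k] in simp)
    moreover have "eventually (\<lambda>x. \<forall>l\<in>K. l \<noteq> k \<longrightarrow> 0 < n k \<bullet> x - \<bar>n l \<bullet> x\<bar>) (nhds (u k))"
    proof (intro eventually_ball_finite K ballI)
      fix l assume l: "l \<in> K"
      show "eventually (\<lambda>x. l \<noteq> k \<longrightarrow> 0 < n k \<bullet> x - \<bar>n l \<bullet> x\<bar>) (nhds (u k))"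
      proof (cases "l = k")
        case False
        have "eventually (\<lambda>x. 0 < n k \<bullet> x - \<bar>n l \<bullet> x\<bar>) (nhds (u k))"
          by (rule order_tendstoD(1)[OF tendsto_diff[OF tn tendsto_rabs[OF tn]]])
            (use u(2)[OF k] u(3)[OF k l False] in simp)
        then show ?thesis by eventually_elim blast
      qed simp
    qed
    ultimately show "eventually (\<lambda>x. ball_norm B' x = n k \<bullet> x) (nhds (u k))"
    proof eventually_elim
      case (elim x)
      \<comment> \<open>The point \<open>x / c\<close> lies on the face plane of slab
        \<open>k\<close>, and the three open conditions, being homogeneous in \<open>x\<close>, put
        it inside all other constraints. This gives the upper bound for the norm.\<close>
      define c where "c = n k \<bullet> x"
      have c: "c > 0" using elim by (simp add: c_def)
      have "(1 / c) *\<^sub>R x \<in> B'"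
        unfolding B'_iff
      proof (intro conjI ballI)
        show "ball_norm B ((1 / c) *\<^sub>R x) \<le> 1 + \<tau>"
          using c ball_norm_scaleR[OF B, of "1 / c" x] \<open>0 < (1 + \<tau>) * (n k \<bullet> x) - ball_norm B x\<close>
          by (simp add: c_def[symmetric] pos_divide_le_eq)
        fix l assume "l \<in> K"
        then have "\<bar>n l \<bullet> x\<bar> \<le> c" using elim c by (cases "l = k") (auto simp: c_def)
        then show "\<bar>n l \<bullet> ((1 / c) *\<^sub>R x)\<bar> \<le> 1" using c by (simp add: abs_mult)
      qed
      then have "ball_norm B' ((1 / c) *\<^sub>R x) \<le> 1" using ball_norm_le_1_iff[OF B'] by blast
      then have le: "ball_norm B' x \<le> c" using c ball_norm_scaleR[OF B', of "1 / c" x] by simp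
      obtain b where b: "b \<in> B'" "x = ball_norm B' x *\<^sub>R b" using ball_normE[OF B'] .
      \<comment> \<open>The reverse bound comes from slab \<open>k\<close> itself:
        \<open>n k\<close> is at most 1 on \<open>B'\<close>.\<close>
      have "c = ball_norm B' x * (n k \<bullet> b)" unfolding c_def by (subst b(2)) simp
      also have "\<dots> \<le> ball_norm B' x * 1"
        using b(1) k ball_norm_nonneg[OF B'] unfolding B'_iff by (intro mult_left_mono) force+
      finally show ?case using le by (simp add: c_def)
    qed
  qed
qed

text \<open>
  The paraboloid \<open>e \<bullet> x + (a \<bullet> x)\<^sup>2 + (b \<bullet> x)\<^sup>2 = R\<close> contains the sumset of the parabolas
  \<open>s \<mapsto> R e + s a - s\<^sup>2 e\<close> and \<open>t \<mapsto> t b - t\<^sup>2 e\<close>; a convex curve in the plane has no such sumset,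
  and this is where dimension at least three enters. The gradients \<open>e + 2 s a + 2 t b\<close> along
  each parabola are dependent, and the small multiple \<open>\<eta>\<close> of the basis vectors makes them independent.
\<close>

lemma paraboloid_grid:
  fixes e a b :: "'a::euclidean_space" and J :: "nat set"
  assumes orth: "pairwise orthogonal E" and unit: "\<And>x. x \<in> E \<Longrightarrow> norm x = 1"
    and indep: "independent E" and span: "span E = UNIV"
    and eab: "e \<in> E" "a \<in> E" "b \<in> E" "a \<noteq> e" "b \<noteq> e" "a \<noteq> b"
    and J: "finite J" and R: "R > 0" and \<epsilon>: "\<epsilon> > 0"
  obtains n :: "'a \<Rightarrow> nat \<Rightarrow> 'a" and p :: "'a \<Rightarrow> 'a" and q :: "nat \<Rightarrow> 'a"
  where "inj_on p E" "inj_on q J"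
    "\<And>i j. i \<in> E \<Longrightarrow> j \<in> J \<Longrightarrow> dist (q j - p i) (R *\<^sub>R e) < \<epsilon>"
    "\<And>i j. i \<in> E \<Longrightarrow> j \<in> J \<Longrightarrow> norm (n i j) < 1 / R + \<epsilon>"
    "\<And>i j. i \<in> E \<Longrightarrow> j \<in> J \<Longrightarrow> n i j \<bullet> (q j - p i) = 1"
    "\<And>i j i' j'. i \<in> E \<Longrightarrow> j \<in> J \<Longrightarrow> i' \<in> E \<Longrightarrow> j' \<in> J \<Longrightarrow> (i', j') \<noteq> (i, j) \<Longrightarrow>
      \<bar>n i' j' \<bullet> (q j - p i)\<bar> < 1"
    "\<And>j x. j \<in> J \<Longrightarrow> (\<And>i. i \<in> E \<Longrightarrow> n i j \<bullet> x = 0) \<Longrightarrow> x = 0"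
proof -
  have fE: "finite E" using indep independent_imp_finite by blast
  have [simp]: "e \<bullet> e = 1" "a \<bullet> a = 1" "b \<bullet> b = 1" "e \<bullet> a = 0" "a \<bullet> e = 0" "e \<bullet> b = 0" "b \<bullet> e = 0" "a \<bullet> b = 0" "b \<bullet> a = 0"
    using orth unit eab by (auto simp: pairwise_def orthogonal_def norm_eq_1)
  obtain f :: "'a \<Rightarrow> nat" where f: "inj_on f E" using finite_imp_inj_to_nat_seg[OF fE] by blast
  \<comment> \<open>Parameters on the second parabola, distinct on \<open>E\<close>. The value 0 at
    \<open>e\<close> leaves the gradient for \<open>i = e\<close> without a component along
    \<open>b\<close>.\<close>
  define t where "t i = (if i = e then 0 else real (Suc (f i)))" for i
  have t: "inj_on t E" "t e = 0" "t b > 0"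
    using f eab by (auto simp: t_def inj_on_def)
  define w where "w i = (if i = e then 0 else i)" for i
  define q where "q \<delta> j = R *\<^sub>R e + (\<delta> * real j) *\<^sub>R a - (\<delta> * real j)\<^sup>2 *\<^sub>R e" for \<delta> j
  define p where "p \<delta> i = (\<delta> * t i)\<^sup>2 *\<^sub>R e - (\<delta> * t i) *\<^sub>R b" for \<delta> i
  \<comment> \<open>For \<open>\<eta> = 0\<close> this is the gradient of the paraboloid's defining
    function at \<open>q \<delta> j - p \<delta> i\<close>; the last term is the tilt. Dividing by
    \<open>c\<close>, its value at that point, will normalise the plane to level 1.\<close>
  define G where "G \<delta> \<eta> i j = e + (2 * (\<delta> * real j)) *\<^sub>R a + (2 * (\<delta> * t i)) *\<^sub>R b + \<eta> *\<^sub>R w i" for \<delta> \<eta> i j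
  define c where "c \<delta> \<eta> i j = G \<delta> \<eta> i j \<bullet> (q \<delta> j - p \<delta> i)" for \<delta> \<eta> i j
  \<comment> \<open>Strict convexity in exact form: the gap below the tangent plane is the squared
    distance of the parameter pairs, scaled by \<open>\<delta>\<^sup>2\<close>.\<close>
  have G0: "G \<delta> 0 i' j' \<bullet> (q \<delta> j - p \<delta> i) = c \<delta> 0 i' j' - \<delta>\<^sup>2 * ((real j' - real j)\<^sup>2 + (t i' - t i)\<^sup>2)" for \<delta> i j i' j'
    unfolding c_def G_def q_def p_def
    by (simp add: inner_add_left inner_add_right inner_diff_left inner_diff_right power2_eq_square algebra_simps)
  define good where "good \<delta> \<eta> i j \<longleftrightarrow> c \<delta> \<eta> i j > 0 \<and> norm (G \<delta> \<eta> i j) / c \<delta> \<eta> i j < 1 / R + \<epsilon>" for \<delta> \<eta> i j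
  \<comment> \<open>A division-free form of the off-diagonal condition
    \<open>\<bar>n i' j' \<bullet> (q j - p i)\<bar> < 1\<close>.\<close>
  define sep where "sep \<delta> \<eta> i j i' j' \<longleftrightarrow> - c \<delta> \<eta> i' j' < G \<delta> \<eta> i' j' \<bullet> (q \<delta> j - p \<delta> i) \<and>
    ((i', j') \<noteq> (i, j) \<longrightarrow> G \<delta> \<eta> i' j' \<bullet> (q \<delta> j - p \<delta> i) < c \<delta> \<eta> i' j')" for \<delta> \<eta> i j i' j'
  have lim_q: "((\<lambda>\<delta>. q \<delta> j) \<longlongrightarrow> R *\<^sub>R e) (at_right 0)" for j
    unfolding q_def by (auto intro!: tendsto_eq_intros)
  have lim_p: "((\<lambda>\<delta>. p \<delta> i) \<longlongrightarrow> 0) (at_right 0)" for i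
    unfolding p_def by (auto intro!: tendsto_eq_intros)
  have lim_G: "((\<lambda>\<delta>. G \<delta> 0 i j) \<longlongrightarrow> e) (at_right 0)" for i j
    unfolding G_def by (auto intro!: tendsto_eq_intros)
  have lim_qp: "((\<lambda>\<delta>. q \<delta> j - p \<delta> i) \<longlongrightarrow> R *\<^sub>R e) (at_right 0)" for i j
    using tendsto_diff[OF lim_q lim_p] by simp
  have lim_in: "((\<lambda>\<delta>. G \<delta> 0 i' j' \<bullet> (q \<delta> j - p \<delta> i)) \<longlongrightarrow> R) (at_right 0)" for i j i' j'
    using tendsto_inner[OF lim_G lim_qp] by simp
  have lim_c: "((\<lambda>\<delta>. c \<delta> 0 i j) \<longlongrightarrow> R) (at_right 0)" for i j
    unfolding c_def by (rule lim_in)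
  have ev_dist: "\<forall>\<^sub>F \<delta> in at_right 0. \<forall>i\<in>E. \<forall>j\<in>J. dist (q \<delta> j - p \<delta> i) (R *\<^sub>R e) < \<epsilon>"
    using lim_qp \<epsilon> by (intro eventually_ball_finite fE J ballI tendstoD)
  have ev_good: "\<forall>\<^sub>F \<delta> in at_right 0. \<forall>i\<in>E. \<forall>j\<in>J. good \<delta> 0 i j"
  proof (intro eventually_ball_finite fE J ballI)
    fix i j
    have "((\<lambda>\<delta>. norm (G \<delta> 0 i j) / c \<delta> 0 i j) \<longlongrightarrow> norm e / R) (at_right 0)"
      using R by (intro tendsto_intros lim_G lim_c) auto
    then have "\<forall>\<^sub>F \<delta> in at_right 0. norm (G \<delta> 0 i j) / c \<delta> 0 i j < 1 / R + \<epsilon>"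
      using unit eab \<epsilon> by (intro order_tendstoD(2)) auto
    then show "\<forall>\<^sub>F \<delta> in at_right 0. good \<delta> 0 i j"
      unfolding good_def by (intro eventually_conj order_tendstoD(1)[OF lim_c R])
  qed
  have ev_sep: "\<forall>\<^sub>F \<delta> in at_right 0. \<forall>i\<in>E. \<forall>j\<in>J. \<forall>i'\<in>E. \<forall>j'\<in>J. sep \<delta> 0 i j i' j'"
  proof (intro eventually_ball_finite fE J ballI)
    fix i j i' j' assume ij: "i \<in> E" "i' \<in> E"
    have "\<forall>\<^sub>F \<delta> in at_right 0. 0 < G \<delta> 0 i' j' \<bullet> (q \<delta> j - p \<delta> i) + c \<delta> 0 i' j'"
      by (rule order_tendstoD(1)[OF tendsto_add[OF lim_in lim_c]]) (use R in simp)
    moreover have "\<forall>\<^sub>F \<delta> in at_right (0::real). \<delta> > 0" by (rule eventually_at_right_less)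
    \<comment> \<open>The upper inequality holds for every positive \<delta> by \<open>G0\<close>;
      only the lower one needs \<delta> small, its limit being \<open>2 * R\<close>.\<close>
    ultimately show "\<forall>\<^sub>F \<delta> in at_right 0. sep \<delta> 0 i j i' j'"
    proof eventually_elim
      case (elim \<delta>)
      have "0 < (real j' - real j)\<^sup>2 + (t i' - t i)\<^sup>2" if "(i', j') \<noteq> (i, j)"
      proof -
        have "real j' - real j \<noteq> 0 \<or> t i' - t i \<noteq> 0" using that t(1) ij by (auto simp: inj_on_def)
        then show ?thesis using sum_power2_gt_zero_iff by blast
      qed
      then show ?case using elim unfolding sep_def G0[of \<delta>] by auto
    qed
  qed
  have "\<forall>\<^sub>F \<delta> in at_right (0::real). \<delta> > 0" by (rule eventually_at_right_less)
  with ev_dist ev_good ev_sep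
  have "\<forall>\<^sub>F \<delta> in at_right 0. \<delta> > 0 \<and> (\<forall>i\<in>E. \<forall>j\<in>J. dist (q \<delta> j - p \<delta> i) (R *\<^sub>R e) < \<epsilon>) \<and>
      (\<forall>i\<in>E. \<forall>j\<in>J. good \<delta> 0 i j) \<and> (\<forall>i\<in>E. \<forall>j\<in>J. \<forall>i'\<in>E. \<forall>j'\<in>J. sep \<delta> 0 i j i' j')"
    by eventually_elim blast
  then obtain \<delta> where \<delta>: "\<delta> > 0" "\<forall>i\<in>E. \<forall>j\<in>J. dist (q \<delta> j - p \<delta> i) (R *\<^sub>R e) < \<epsilon>"
      "\<forall>i\<in>E. \<forall>j\<in>J. good \<delta> 0 i j" "\<forall>i\<in>E. \<forall>j\<in>J. \<forall>i'\<in>E. \<forall>j'\<in>J. sep \<delta> 0 i j i' j'"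
    using eventually_happens'[OF trivial_limit_at_right_real] by blast
  \<comment> \<open>Now \<delta> stays fixed. The conditions obtained at \<open>\<eta> = 0\<close>
    are finitely many strict inequalities, continuous in \<eta>, so they survive a small positive
    tilt.\<close>
  have lim_G': "((\<lambda>\<eta>. G \<delta> \<eta> i j) \<longlongrightarrow> G \<delta> 0 i j) (at_right 0)" for i j
    unfolding G_def by (auto intro!: tendsto_eq_intros)
  have lim_in': "((\<lambda>\<eta>. G \<delta> \<eta> i' j' \<bullet> (q \<delta> j - p \<delta> i)) \<longlongrightarrow> G \<delta> 0 i' j' \<bullet> (q \<delta> j - p \<delta> i)) (at_right 0)" for i j i' j'
    by (intro tendsto_intros lim_G')
  have lim_c': "((\<lambda>\<eta>. c \<delta> \<eta> i j) \<longlongrightarrow> c \<delta> 0 i j) (at_right 0)" for i j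
    unfolding c_def by (rule lim_in')
  have ev_good': "\<forall>\<^sub>F \<eta> in at_right 0. \<forall>i\<in>E. \<forall>j\<in>J. good \<delta> \<eta> i j"
  proof (intro eventually_ball_finite fE J ballI)
    fix i j assume "i \<in> E" "j \<in> J"
    then have *: "c \<delta> 0 i j > 0" "norm (G \<delta> 0 i j) / c \<delta> 0 i j < 1 / R + \<epsilon>"
      using \<delta>(3) by (auto simp: good_def)
    have "((\<lambda>\<eta>. norm (G \<delta> \<eta> i j) / c \<delta> \<eta> i j) \<longlongrightarrow> norm (G \<delta> 0 i j) / c \<delta> 0 i j) (at_right 0)"
      using * by (intro tendsto_intros lim_G' lim_c') auto
    from order_tendstoD(2)[OF this *(2)] order_tendstoD(1)[OF lim_c' *(1)]
    show "\<forall>\<^sub>F \<eta> in at_right 0. good \<delta> \<eta> i j"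
      unfolding good_def by eventually_elim blast
  qed
  have ev_sep': "\<forall>\<^sub>F \<eta> in at_right 0. \<forall>i\<in>E. \<forall>j\<in>J. \<forall>i'\<in>E. \<forall>j'\<in>J. sep \<delta> \<eta> i j i' j'"
  proof (intro eventually_ball_finite fE J ballI)
    fix i j i' j' assume "i \<in> E" "j \<in> J" "i' \<in> E" "j' \<in> J"
    then have s: "sep \<delta> 0 i j i' j'" using \<delta>(4) by blast
    have "\<forall>\<^sub>F \<eta> in at_right 0. 0 < G \<delta> \<eta> i' j' \<bullet> (q \<delta> j - p \<delta> i) + c \<delta> \<eta> i' j'"
      using tendsto_add[OF lim_in'[of i' j' j i] lim_c'[of i' j']] s
      by (rule_tac order_tendstoD(1)) (auto simp: sep_def)
    moreover have "\<forall>\<^sub>F \<eta> in at_right 0. (i', j') \<noteq> (i, j) \<longrightarrow> G \<delta> \<eta> i' j' \<bullet> (q \<delta> j - p \<delta> i) - c \<delta> \<eta> i' j' < 0"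
    proof (cases "(i', j') = (i, j)")
      case False
      then have "\<forall>\<^sub>F \<eta> in at_right 0. G \<delta> \<eta> i' j' \<bullet> (q \<delta> j - p \<delta> i) - c \<delta> \<eta> i' j' < 0"
        using tendsto_diff[OF lim_in'[of i' j' j i] lim_c'[of i' j']] s
        by (rule_tac order_tendstoD(2)) (auto simp: sep_def)
      then show ?thesis by eventually_elim blast
    qed simp
    ultimately show "\<forall>\<^sub>F \<eta> in at_right 0. sep \<delta> \<eta> i j i' j'"
      by eventually_elim (auto simp: sep_def)
  qed
  have "\<forall>\<^sub>F \<eta> in at_right (0::real). \<eta> > 0" by (rule eventually_at_right_less)
  with ev_good' ev_sep'
  have "\<forall>\<^sub>F \<eta> in at_right 0. \<eta> > 0 \<and> (\<forall>i\<in>E. \<forall>j\<in>J. good \<delta> \<eta> i j) \<and>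
      (\<forall>i\<in>E. \<forall>j\<in>J. \<forall>i'\<in>E. \<forall>j'\<in>J. sep \<delta> \<eta> i j i' j')"
    by eventually_elim blast
  then obtain \<eta> where \<eta>: "\<eta> > 0" "\<forall>i\<in>E. \<forall>j\<in>J. good \<delta> \<eta> i j"
      "\<forall>i\<in>E. \<forall>j\<in>J. \<forall>i'\<in>E. \<forall>j'\<in>J. sep \<delta> \<eta> i j i' j'"
    using eventually_happens'[OF trivial_limit_at_right_real] by blast
  define n where "n i j = (1 / c \<delta> \<eta> i j) *\<^sub>R G \<delta> \<eta> i j" for i j
  have c: "c \<delta> \<eta> i j > 0" if "i \<in> E" "j \<in> J" for i j using \<eta>(2) that by (auto simp: good_def)
  show thesis
  proof (rule that[of "p \<delta>" "q \<delta>" n])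
    show "inj_on (p \<delta>) E"
    proof (rule inj_onI)
      fix x y assume xy: "x \<in> E" "y \<in> E" "p \<delta> x = p \<delta> y"
      have "b \<bullet> p \<delta> x = b \<bullet> p \<delta> y" using xy by simp
      then have "t x = t y" using \<delta>(1) by (simp add: p_def inner_diff_right)
      then show "x = y" using t(1) xy by (auto simp: inj_on_def)
    qed
    show "inj_on (q \<delta>) J"
    proof (rule inj_onI)
      fix x y assume "q \<delta> x = q \<delta> y"
      then have "a \<bullet> q \<delta> x = a \<bullet> q \<delta> y" by simp
      then show "x = y" using \<delta>(1) by (simp add: q_def inner_diff_right inner_add_right)
    qed
    fix i j assume ij: "i \<in> E" "j \<in> J"
    show "dist (q \<delta> j - p \<delta> i) (R *\<^sub>R e) < \<epsilon>" using \<delta>(2) ij by blast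
    show "norm (n i j) < 1 / R + \<epsilon>" using \<eta>(2) ij abs_of_pos[OF c[OF ij]] by (simp add: n_def good_def)
    show "n i j \<bullet> (q \<delta> j - p \<delta> i) = 1" using c[OF ij] by (simp add: n_def c_def)
  next
    fix i j i' j' assume ij: "i \<in> E" "j \<in> J" "i' \<in> E" "j' \<in> J" and ne: "(i', j') \<noteq> (i, j)"
    then have "sep \<delta> \<eta> i j i' j'" using \<eta>(3) by blast
    then show "\<bar>n i' j' \<bullet> (q \<delta> j - p \<delta> i)\<bar> < 1"
      using ne c[OF ij(3,4)] unfolding sep_def n_def by (simp add: abs_mult abs_less_iff)
  next
    fix j x assume j: "j \<in> J" and x: "\<And>i. i \<in> E \<Longrightarrow> n i j \<bullet> x = 0"
    have Gx: "G \<delta> \<eta> i j \<bullet> x = 0" if "i \<in> E" for i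
      using x[OF that] c[OF that j] by (simp add: n_def)
    have e0: "e \<bullet> x + 2 * (\<delta> * real j) * (a \<bullet> x) = 0"
      using Gx[OF eab(1)] by (simp add: G_def w_def t inner_add_left)
    have rest: "2 * (\<delta> * t i) * (b \<bullet> x) + \<eta> * (i \<bullet> x) = 0" if "i \<in> E" "i \<noteq> e" for i
      using Gx[OF that(1)] e0 that by (simp add: G_def w_def inner_add_left)
    \<comment> \<open>For \<open>i = b\<close> the parabola term and the tilt both point along
      \<open>b\<close> with positive coefficients, so they cannot cancel. The other equations then
      reduce to the tilt alone.\<close>
    have "(2 * (\<delta> * t b) + \<eta>) * (b \<bullet> x) = 0" using rest[of b] eab by (simp add: algebra_simps)
    moreover have "2 * (\<delta> * t b) + \<eta> > 0" using \<delta>(1) \<eta>(1) t(3) by (intro add_pos_pos) auto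
    ultimately have bx: "b \<bullet> x = 0" by simp
    then have "i \<bullet> x = 0" if "i \<in> E" "i \<noteq> e" for i using rest[OF that] \<eta>(1) by simp
    moreover from this have "e \<bullet> x = 0" using e0 eab by simp
    ultimately have "orthogonal x i" if "i \<in> E" for i
      using that by (cases "i = e") (auto simp: orthogonal_def inner_commute)
    then have "orthogonal x x" using orthogonal_to_span[of x E x] span by auto
    then show "x = 0" by (simp add: orthogonal_def)
  qed
qed

section \<open>Density of stable configurations and the category argument\<close>

text \<open>With \<open>v\<close> farthest from the origin, \<open>B\<close> lies in the ball of
  radius \<open>R = norm v\<close>, so a slab with normal of length about \<open>1 / R\<close>
  nearly contains \<open>B\<close>. The grid near \<open>v = R e\<close> has such normals, and
  truncating there changes \<open>B\<close> only slightly.\<close>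

lemma dense_stable_complete_bipartite:
  fixes B :: "'a::euclidean_space set"
  assumes dim: "DIM('a) \<ge> 3" and B: "B \<in> unit_balls" and \<epsilon>: "\<epsilon> > 0"
  obtains B' \<delta> where "B' \<in> unit_balls" "hausdorff_dist B B' < \<epsilon>" "\<delta> > 0"
    "\<And>C. C \<in> unit_balls \<Longrightarrow> hausdorff_dist B' C < \<delta> \<Longrightarrow>
      contains_complete_bipartite (unit_distance_graph (ball_norm C)) DIM('a) m"
proof -
  note pB = unit_ball_props[OF B]
  obtain v where v: "v \<in> B" "\<And>x. x \<in> B \<Longrightarrow> norm x \<le> norm v"
    using continuous_attains_sup[OF pB(5,1) continuous_on_norm_id] by auto
  define R where "R = norm v"
  obtain \<rho> where \<rho>: "\<rho> > 0" "cball 0 \<rho> \<subseteq> B" using unit_ball_cball[OF B] .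
  have BR: "B \<subseteq> cball 0 R" using v by (auto simp: R_def)
  have R: "R > 0"
  proof -
    obtain x :: 'a where "norm x = \<rho>" using vector_choose_size[of \<rho>] \<rho> by auto
    then have "x \<in> B" using \<rho> by auto
    then show ?thesis using v(2) \<open>norm x = \<rho>\<close> \<rho> by (force simp: R_def)
  qed
  define e where "e = (1 / R) *\<^sub>R v"
  have e: "norm e = 1" "R *\<^sub>R e = v" using R by (auto simp: e_def R_def)
  obtain E where E: "e \<in> E" "pairwise orthogonal E" "\<And>x. x \<in> E \<Longrightarrow> norm x = 1"
    "independent E" "card E = DIM('a)" "span E = UNIV"
    using vector_in_orthonormal_basis[OF e(1)] by blast
  have fE: "finite E" using E(4) independent_imp_finite by blast
  obtain a where a: "a \<in> E" "a \<noteq> e"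
    using dim E(5) card_mono[of "{e}" E] by (auto simp: subset_iff)
  have "\<not> E \<subseteq> {e, a}" using dim E(5) card_mono[of "{e, a}" E] card_insert_le_m1[of 2 "{a}" e] by auto
  then obtain b where b: "b \<in> E" "b \<noteq> e" "b \<noteq> a" by blast
  \<comment> \<open>The factor 2 yields the strict bound \<open>\<tau> * R < \<epsilon>\<close>,
    because the truncation only guarantees distance at most \<open>\<tau> * R\<close>.\<close>
  define \<tau> where "\<tau> = min (1 / 2) (\<epsilon> / (2 * R))"
  have \<tau>: "0 < \<tau>" "\<tau> < 1" "\<tau> * R < \<epsilon>"
  proof -
    show "0 < \<tau>" "\<tau> < 1" using R \<epsilon> by (auto simp: \<tau>_def)
    have "\<tau> * R \<le> \<epsilon> / (2 * R) * R" using R by (intro mult_right_mono) (auto simp: \<tau>_def)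
    then show "\<tau> * R < \<epsilon>" using R \<epsilon> by simp
  qed
  \<comment> \<open>The first entry keeps the grid points inside the dilate by
    \<open>1 + \<tau>\<close>. The second bounds the normals by \<open>(1 + \<tau>) / R\<close>, and
    \<open>(1 + \<tau>) * (1 - \<tau>) \<le> 1\<close> is what the slabs require.\<close>
  define \<theta> where "\<theta> = min (\<rho> * \<tau>) (\<tau> / R)"
  have \<theta>: "\<theta> > 0" "\<theta> \<le> \<rho> * \<tau>" "\<theta> \<le> \<tau> / R" using \<rho> \<tau> R by (auto simp: \<theta>_def)
  show thesis
  proof (rule paraboloid_grid[OF E(2,3,4,6,1) a(1) b(1) a(2) b(2) b(3)[symmetric] finite_lessThan[of m] R \<theta>(1)])
    fix n p q
    assume inj_p: "inj_on p E" and inj_q: "inj_on q {..<m}"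
      and near: "\<And>i j. i \<in> E \<Longrightarrow> j \<in> {..<m} \<Longrightarrow> dist (q j - p i) (R *\<^sub>R e) < \<theta>"
      and norm_n: "\<And>i j. i \<in> E \<Longrightarrow> j \<in> {..<m} \<Longrightarrow> norm (n i j) < 1 / R + \<theta>"
      and diag: "\<And>i j. i \<in> E \<Longrightarrow> j \<in> {..<m} \<Longrightarrow> n i j \<bullet> (q j - p i) = 1"
      and offdiag: "\<And>i j i' j'. i \<in> E \<Longrightarrow> j \<in> {..<m} \<Longrightarrow> i' \<in> E \<Longrightarrow> j' \<in> {..<m} \<Longrightarrow>
        (i', j') \<noteq> (i, j) \<Longrightarrow> \<bar>n i' j' \<bullet> (q j - p i)\<bar> < 1"
      and ker: "\<And>j x. j \<in> {..<m} \<Longrightarrow> (\<And>i. i \<in> E \<Longrightarrow> n i j \<bullet> x = 0) \<Longrightarrow> x = 0"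
    have "\<exists>B'\<in>unit_balls. hausdorff_dist B B' \<le> \<tau> * R \<and>
      (\<forall>k\<in>E \<times> {..<m}. eventually (\<lambda>x. ball_norm B' x = (case k of (i, j) \<Rightarrow> n i j) \<bullet> x)
        (nhds (case k of (i, j) \<Rightarrow> q j - p i)))"
    proof (rule slab_truncation[OF B BR \<tau>(1,2), of "E \<times> {..<m}" "\<lambda>(i, j). n i j" "\<lambda>(i, j). q j - p i"], goal_cases)
      case (2 k)
      then obtain i j where k: "k = (i, j)" "i \<in> E" "j \<in> {..<m}" by auto
      have "norm (n i j) \<le> 1 / R + \<tau> / R" using norm_n[OF k(2,3)] \<theta> by simp
      then have "norm (n i j) * ((1 - \<tau>) * R) \<le> (1 / R + \<tau> / R) * ((1 - \<tau>) * R)"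
        using \<tau> R by (intro mult_right_mono) auto
      also have "\<dots> = 1 - \<tau> * \<tau>" using R by (simp add: field_simps)
      also have "\<dots> \<le> 1" by simp
      finally show ?case by (simp add: k)
    next
      case (3 k)
      then obtain i j where k: "k = (i, j)" "i \<in> E" "j \<in> {..<m}" by auto
      have "ball_norm B (q j - p i - v) \<le> norm (q j - p i - v) / \<rho>" by (rule ball_norm_le_norm[OF B \<rho>])
      also have "\<dots> < \<theta> / \<rho>" using near[OF k(2,3)] \<rho> by (simp add: e dist_norm divide_strict_right_mono)
      also have "\<dots> \<le> \<tau>" using \<theta> \<rho> by (simp add: field_simps)
      finally have "ball_norm B (q j - p i - v) < \<tau>" .
      moreover have "ball_norm B v \<le> 1" using ball_norm_le_1_iff[OF B] v by blast
      ultimately show ?case using ball_norm_triangle[OF B, of "q j - p i - v" v] by (simp add: k)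
    next
      case (4 k)
      then show ?case using diag by auto
    next
      case (5 k l)
      then show ?case using offdiag by auto
    qed (use fE in auto)
    then obtain B' where B': "B' \<in> unit_balls" "hausdorff_dist B B' \<le> \<tau> * R"
      "\<And>i j. i \<in> E \<Longrightarrow> j \<in> {..<m} \<Longrightarrow> eventually (\<lambda>x. ball_norm B' x = n i j \<bullet> x) (nhds (q j - p i))"
      by fastforce
    have affine: "eventually (\<lambda>x. ball_norm B' (x - p i) = 1 + n i j \<bullet> (x - q j)) (nhds (q j))"
      if ij: "i \<in> E" "j \<in> {..<m}" for i j
    proof -
      have "filterlim (\<lambda>x. x - p i) (nhds (q j - p i)) (nhds (q j))"
        by (intro tendsto_intros filterlim_ident)
      with B'(3)[OF ij] have "eventually (\<lambda>x. ball_norm B' (x - p i) = n i j \<bullet> (x - p i)) (nhds (q j))"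
        by (rule eventually_compose_filterlim)
      then show ?thesis
      proof eventually_elim
        case (elim x)
        then show ?case using diag[OF ij] by (simp add: inner_diff_right)
      qed
    qed
    show thesis
    proof (rule stable_complete_bipartite[OF B'(1) E(4) finite_lessThan[of m] inj_p inj_q, of n])
      fix \<delta> assume "\<delta> > 0" "\<And>C. C \<in> unit_balls \<Longrightarrow> hausdorff_dist B' C < \<delta> \<Longrightarrow>
        contains_complete_bipartite (unit_distance_graph (ball_norm C)) (card E) (card {..<m})"
      then show thesis using that[of B' \<delta>] B' \<tau>(3) E(5) by auto
    qed (use ker affine in blast)+
  qed
qed

theorem theorem1p5:
  assumes "CARD('n::finite) \<ge> 3"
  shows "\<exists>\<A>. comeagre_in (unit_ball_topology :: (real ^ 'n) set topology) \<A> \<and>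
    (\<forall>B\<in>\<A>. \<forall>m::nat. m \<ge> 1 \<longrightarrow>
      contains_complete_bipartite (unit_distance_graph (ball_norm B)) CARD('n) m)"
proof -
  \<comment> \<open>One set for each \<open>m\<close>, so the intersection is countable. Only the
    interior of \<open>U m\<close> has to be dense: near any \<open>B\<close> there is a
    \<open>B'\<close> with a whole metric ball around it inside \<open>U m\<close>.\<close>
  define U where "U m = {B \<in> unit_balls. contains_complete_bipartite
    (unit_distance_graph (ball_norm (B :: (real ^ 'n) set))) CARD('n) m}" for m
  have dim: "DIM(real ^ 'n) = CARD('n)" by simp
  have dense: "unit_ball_topology closure_of (unit_ball_topology interior_of U m) = unit_balls" for m
  proof (intro equalityI subsetI)
    fix B :: "(real ^ 'n) set" assume B: "B \<in> unit_balls"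
    show "B \<in> unit_ball_topology closure_of (unit_ball_topology interior_of U m)"
      unfolding unit_ball_topology_def Metric_space.metric_closure_of[OF Metric_space_unit_balls]
        Metric_space.metric_interior_of[OF Metric_space_unit_balls]
    proof (intro CollectI conjI allI impI B)
      fix r :: real assume "r > 0"
      then obtain B' \<delta> where B': "B' \<in> unit_balls" "hausdorff_dist B B' < r" "\<delta> > 0"
        "\<And>C. C \<in> unit_balls \<Longrightarrow> hausdorff_dist B' C < \<delta> \<Longrightarrow>
          contains_complete_bipartite (unit_distance_graph (ball_norm C)) DIM(real ^ 'n) m"
        using dense_stable_complete_bipartite[of B r m] assms B unfolding dim by metis
      then have "Metric_space.mball unit_balls hausdorff_dist B' \<delta> \<subseteq> U m"
        by (auto simp: Metric_space.in_mball[OF Metric_space_unit_balls] U_def)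
      then show "\<exists>y\<in>{x \<in> unit_balls. \<exists>\<epsilon>>0. Metric_space.mball unit_balls hausdorff_dist x \<epsilon> \<subseteq> U m}.
          y \<in> Metric_space.mball unit_balls hausdorff_dist B r"
        using B B' by (auto simp: Metric_space.in_mball[OF Metric_space_unit_balls])
    qed
  qed (use closure_of_subset_topspace[of unit_ball_topology] in auto)
  have "comeagre_in unit_ball_topology (unit_balls \<inter> \<Inter>(range U))"
    unfolding comeagre_in_def
    by (intro exI[of _ "range U"]) (auto simp: dense, auto simp: U_def)
  then show ?thesis by (intro exI[of _ "unit_balls \<inter> \<Inter>(range U)"]) (auto simp: U_def)
qed

end
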